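(* For each commutative reduced ring $R$ with unity: (a) $|\mathcal{B}(R)| \leqslant \mathrm{dt}_t(\mathbb{AG}(R))$. (b) If $|\mathrm{Min}(R)| > 2$, then $|\mathcal{B}(R)| \leqslant \mathrm{dt}(\mathbb{AG}(R))$.
   Context: For $S\subseteq R$, $\mathrm{Ann}(S)=\{x\in R: Sx=\{0\}\}$. $\mathbb{A}(R)^*$ is the set of non-zero ideals $I$ of $R$ with $\mathrm{Ann}(I)\neq\{0\}$; the annihilating-ideal graph $\mathbb{AG}(R)$ has vertex set $\mathbb{A}(R)^*$, distinct $I,J$ being adjacent iff $IJ=\{0\}$. $\mathrm{Min}(R)$ is the set of minimal prime ideals of $R$. $\mathcal{B}(R)$ is the set of prime ideals $P$ of $R$ with $P=\mathrm{Ann}(x)$ for some $x\in R$ (Bourbaki associated prime divisors of the zero ideal). For a graph $G$, a dominating set is a set $D$ of vertices such that every vertex is in $D$ or adjacent to some vertex of $D$; a total dominating set is a set $S$ of vertices such that every vertex is adjacent to some vertex of $S$; $\mathrm{dt}(G)$ and $\mathrm{dt}_t(G)$ are the minimum cardinalities of a dominating set and of a total dominating set, respectively.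
   Formalization: Part (a) is stated for rings that are not integral domains: for an integral domain the annihilating-ideal graph has no vertices, so its total domination number is 0, while the zero ideal Ann(1) is prime and gives one Bourbaki prime, so (a) fails there. *)

theory Defs
  imports "HOL-Algebra.Algebra"
begin

unbundle cardinal_syntax

record 'v graph =
  vertices :: "'v set"
  adjacent :: "'v \<Rightarrow> 'v \<Rightarrow> bool"

definition dominating_set :: "'v graph \<Rightarrow> 'v set \<Rightarrow> bool" where
  "dominating_set G D \<longleftrightarrow>
     D \<subseteq> vertices G \<and> (\<forall>v\<in>vertices G. v \<in> D \<or> (\<exists>d\<in>D. adjacent G v d))"

definition total_dominating_set :: "'v graph \<Rightarrow> 'v set \<Rightarrow> bool" where
  "total_dominating_set G S \<longleftrightarrow>
     S \<subseteq> vertices G \<and> (\<forall>v\<in>vertices G. \<exists>s\<in>S. adjacent G v s)"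

(* The least cardinality of a member of F, as a possibly infinite cardinal (represented, as for
   card_of, by a well-order). It is unspecified if F is empty. *)
definition min_cardinality :: "'v set set \<Rightarrow> 'v rel" where
  "min_cardinality F = (SOME c. c \<in> card_of ` F \<and> (\<forall>A\<in>F. c \<le>o |A| ))"

lemma min_cardinality:
  assumes "F \<noteq> {}"
  shows "min_cardinality F \<in> card_of ` F" and "\<And>A. A \<in> F \<Longrightarrow> min_cardinality F \<le>o |A|"
proof -
  have "\<exists>c. c \<in> card_of ` F \<and> (\<forall>A\<in>F. c \<le>o |A| )"
    using exists_minim_Card_order[of "card_of ` F"] assms by auto
  from someI_ex[OF this] show "min_cardinality F \<in> card_of ` F"
    and "\<And>A. A \<in> F \<Longrightarrow> min_cardinality F \<le>o |A|"
    unfolding min_cardinality_def by auto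
qed

definition domination_number :: "'v graph \<Rightarrow> 'v rel" where
  "domination_number G = min_cardinality {D. dominating_set G D}"

(* A total dominating set exists iff G has no isolated vertices. This holds for the
   annihilating-ideal graph of a reduced ring: a vertex I is adjacent to Ann(I). *)
definition total_domination_number :: "'v graph \<Rightarrow> 'v rel" where
  "total_domination_number G = min_cardinality {S. total_dominating_set G S}"

definition reduced_ring :: "('a, 'b) ring_scheme \<Rightarrow> bool" where
  "reduced_ring R \<longleftrightarrow> (\<forall>x\<in>carrier R. \<forall>n::nat. x [^]\<^bsub>R\<^esub> n = \<zero>\<^bsub>R\<^esub> \<longrightarrow> x = \<zero>\<^bsub>R\<^esub>)"

definition annihilator :: "('a, 'b) ring_scheme \<Rightarrow> 'a set \<Rightarrow> 'a set" where
  "annihilator R S = {x \<in> carrier R. \<forall>s\<in>S. s \<otimes>\<^bsub>R\<^esub> x = \<zero>\<^bsub>R\<^esub>}"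

definition annihilating_ideals :: "('a, 'b) ring_scheme \<Rightarrow> 'a set set" where
  "annihilating_ideals R =
     {I. ideal I R \<and> I \<noteq> {\<zero>\<^bsub>R\<^esub>} \<and> annihilator R I \<noteq> {\<zero>\<^bsub>R\<^esub>}}"

definition annihilating_ideal_graph :: "('a, 'b) ring_scheme \<Rightarrow> 'a set graph" where
  "annihilating_ideal_graph R =
     \<lparr> vertices = annihilating_ideals R,
       adjacent = (\<lambda>I J. I \<in> annihilating_ideals R \<and> J \<in> annihilating_ideals R \<and>
                         I \<noteq> J \<and> I \<cdot>\<^bsub>R\<^esub> J = {\<zero>\<^bsub>R\<^esub>}) \<rparr>"

definition minimal_primes :: "('a, 'b) ring_scheme \<Rightarrow> 'a set set" where
  "minimal_primes R = {P. primeideal P R \<and> (\<forall>Q. primeideal Q R \<and> Q \<subseteq> P \<longrightarrow> Q = P)}"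

definition bourbaki_primes :: "('a, 'b) ring_scheme \<Rightarrow> 'a set set" where
  "bourbaki_primes R = {P. primeideal P R \<and> (\<exists>x\<in>carrier R. P = annihilator R {x})}"

end

theory Submission
  imports Defs
begin

text \<open>
  Distinct primes \<open>P\<close> and \<open>Q\<close> that are annihilators of elements are incomparable. If an ideal \<open>S\<close>
  satisfies \<open>SP = SQ = 0\<close>, then \<open>SP \<subseteq> Q\<close> forces \<open>S \<subseteq> Q\<close>, so \<open>S\<^sup>2 \<subseteq> SQ = 0\<close> and \<open>S = 0\<close> since the ring
  is reduced. Hence no vertex is adjacent to two of these primes, and sending a prime to a neighbour
  in a total dominating set is injective. For a dominating set \<open>D\<close>, send the primes in \<open>D\<close> to
  themselves and the others to a neighbour in \<open>D\<close>; a collision means \<open>PQ = 0\<close> for some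
  \<open>P \<noteq> Q\<close>, so every prime contains \<open>P\<close> or \<open>Q\<close> and there are at most two minimal primes.
\<close>

lemma bourbaki_primesE:
  assumes "P \<in> bourbaki_primes R"
  obtains x where "primeideal P R" "x \<in> carrier R" "\<forall>a. a \<in> P \<longleftrightarrow> a \<in> carrier R \<and> x \<otimes>\<^bsub>R\<^esub> a = \<zero>\<^bsub>R\<^esub>"
  using assms by (auto simp: bourbaki_primes_def annihilator_def)

text \<open>A choice function for \<open>r\<close> is injective, since no \<open>y\<close> is
  related to two elements of \<open>A\<close>. The cardinals may be infinite.\<close>

lemma inj_choice_card_le:
  assumes "\<And>x. x \<in> A \<Longrightarrow> \<exists>y\<in>B. r x y"
    and "\<And>x x' y. x \<in> A \<Longrightarrow> x' \<in> A \<Longrightarrow> r x y \<Longrightarrow> r x' y \<Longrightarrow> x = x'"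
  shows "|A| \<le>o |B|"
proof -
  obtain f where "\<And>x. x \<in> A \<Longrightarrow> f x \<in> B \<and> r x (f x)"
    using assms(1) by metis
  moreover from this have "inj_on f A"
    by (metis assms(2) inj_onI)
  ultimately show ?thesis
    by (auto intro!: card_of_ordLeqI)
qed

lemma adjacent_annihilating_ideal_graph:
  "adjacent (annihilating_ideal_graph R) I J \<longleftrightarrow>
     I \<in> annihilating_ideals R \<and> J \<in> annihilating_ideals R \<and> I \<noteq> J \<and> I \<cdot>\<^bsub>R\<^esub> J = {\<zero>\<^bsub>R\<^esub>}"
  by (simp add: annihilating_ideal_graph_def)

lemma vertices_annihilating_ideal_graph:
  "vertices (annihilating_ideal_graph R) = annihilating_ideals R"
  by (simp add: annihilating_ideal_graph_def)

context cring
begin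

lemma ideal_annihilator:
  assumes "ideal I R"
  shows "ideal (annihilator R I) R"
proof -
  interpret I: ideal I R by fact
  show ?thesis
  proof (rule idealI)
    show "ring R" by (rule ring_axioms)
    show "subgroup (annihilator R I) (add_monoid R)"
    proof (rule add.subgroupI)
      show "annihilator R I \<noteq> {}"
        using I.Icarr by (auto simp: annihilator_def intro!: exI[of _ \<zero>])
    qed (use I.Icarr in \<open>auto simp: annihilator_def r_distr r_minus simp flip: a_inv_def\<close>)
    show "x \<otimes> a \<in> annihilator R I" if "a \<in> annihilator R I" "x \<in> carrier R" for a x
      using that I.Icarr by (auto simp: annihilator_def m_lcomm[of _ x])
    show "a \<otimes> x \<in> annihilator R I" if "a \<in> annihilator R I" "x \<in> carrier R" for a x
      using that I.Icarr by (auto simp: annihilator_def simp flip: m_assoc)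
  qed
qed

text \<open>Elements of \<open>I \<cdot> J\<close> are finite sums of products, so induction over
  such sums reduces adjacency to a condition on pairs of elements.\<close>

lemma ideal_prod_eq_zero_iff:
  assumes "ideal I R" "ideal J R"
  shows "I \<cdot> J = {\<zero>} \<longleftrightarrow> (\<forall>a\<in>I. \<forall>b\<in>J. a \<otimes> b = \<zero>)"
proof
  assume "I \<cdot> J = {\<zero>}"
  then show "\<forall>a\<in>I. \<forall>b\<in>J. a \<otimes> b = \<zero>"
    using ideal_prod.prod by fastforce
next
  assume zero: "\<forall>a\<in>I. \<forall>b\<in>J. a \<otimes> b = \<zero>"
  have "x = \<zero>" if "x \<in> I \<cdot> J" for x
    using that by (induction rule: ideal_prod.induct) (use zero in auto)
  moreover have "\<zero> \<in> I \<cdot> J"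
    using ideal_prod_is_ideal[OF assms] additive_subgroup.zero_closed ideal.axioms(1) by blast
  ultimately show "I \<cdot> J = {\<zero>}" by blast
qed

lemma reduced_square_eq_zero:
  assumes "reduced_ring R" "x \<in> carrier R" "x \<otimes> x = \<zero>"
  shows "x = \<zero>"
proof -
  have "x [^] (2::nat) = \<zero>"
    using assms by (simp add: numeral_2_eq_2)
  then show ?thesis
    using assms unfolding reduced_ring_def by blast
qed

text \<open>Write \<open>Q\<close> as the annihilator of \<open>y\<close>. Reducedness keeps
  \<open>y\<close> out of \<open>Q\<close>, hence out of \<open>P\<close>; for \<open>a\<close> in
  \<open>Q\<close> the product \<open>y \<otimes> a\<close> is zero, so it lies in \<open>P\<close>
  and primality puts \<open>a\<close> in \<open>P\<close>.\<close>

lemma bourbaki_primes_subset_imp_eq: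
  assumes red: "reduced_ring R"
    and P: "P \<in> bourbaki_primes R" and Q: "Q \<in> bourbaki_primes R" and sub: "P \<subseteq> Q"
  shows "P = Q"
proof
  obtain y where "primeideal Q R"
    and y: "y \<in> carrier R" "\<forall>a. a \<in> Q \<longleftrightarrow> a \<in> carrier R \<and> y \<otimes> a = \<zero>"
    using Q by (rule bourbaki_primesE)
  interpret Q: primeideal Q R by fact
  interpret P: primeideal P R using P by (rule bourbaki_primesE)
  have "y \<notin> Q"
  proof
    assume "y \<in> Q"
    then have "y = \<zero>" using y reduced_square_eq_zero[OF red] by blast
    then have "carrier R = Q" using y(2) l_null by blast
    then show False using Q.I_notcarr by contradiction
  qed
  show "Q \<subseteq> P"
  proof
    fix a assume "a \<in> Q"
    then have "y \<otimes> a \<in> P" "a \<in> carrier R"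
      using y(2) P.zero_closed by auto
    then show "a \<in> P" using P.I_prime[of y a] y(1) \<open>y \<notin> Q\<close> sub by blast
  qed
qed (fact sub)

lemma bourbaki_primes_common_neighbour:
  assumes red: "reduced_ring R"
    and P: "P \<in> bourbaki_primes R" and Q: "Q \<in> bourbaki_primes R"
    and adj: "adjacent (annihilating_ideal_graph R) P S" "adjacent (annihilating_ideal_graph R) Q S"
  shows "P = Q"
proof (rule ccontr)
  assume "P \<noteq> Q"
  then obtain p where p: "p \<in> P" "p \<notin> Q"
    using bourbaki_primes_subset_imp_eq[OF red P Q] by blast
  interpret P: primeideal P R using P by (rule bourbaki_primesE)
  interpret Q: primeideal Q R using Q by (rule bourbaki_primesE)
  have S: "ideal S R" "S \<noteq> {\<zero>}"
    using adj by (auto simp: adjacent_annihilating_ideal_graph annihilating_ideals_def)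
  interpret S: ideal S R by (rule S)
  have zero: "a \<otimes> s = \<zero>" if "a \<in> P \<or> a \<in> Q" "s \<in> S" for a s
    using adj that ideal_prod_eq_zero_iff[OF P.is_ideal S(1)] ideal_prod_eq_zero_iff[OF Q.is_ideal S(1)]
    by (auto simp: adjacent_annihilating_ideal_graph)
  have "s = \<zero>" if "s \<in> S" for s
  proof -
    have "p \<otimes> s \<in> Q" using zero p that by auto
    then have "s \<in> Q" using Q.I_prime p P.Icarr S.Icarr that by blast
    \<comment> \<open>Now \<open>s\<close> lies in both \<open>Q\<close> and \<open>S\<close>, so
      \<open>zero\<close> makes its square vanish.\<close>
    then show ?thesis
      using zero that S.Icarr reduced_square_eq_zero[OF red] by blast
  qed
  then show False using S by auto
qed

text \<open>In a domain the zero ideal is prime and the annihilator of \<open>\<one>\<close>, yet it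
  is not a vertex. Otherwise \<open>P\<close> is nonzero, and the \<open>x\<close> with annihilator
  \<open>P\<close> is a nonzero element annihilating \<open>P\<close>.\<close>

lemma bourbaki_primes_are_vertices:
  assumes "\<not> domain R" "P \<in> bourbaki_primes R"
  shows "P \<in> annihilating_ideals R"
proof -
  obtain x where "primeideal P R"
    and x: "x \<in> carrier R" "\<forall>a. a \<in> P \<longleftrightarrow> a \<in> carrier R \<and> x \<otimes> a = \<zero>"
    using assms(2) by (rule bourbaki_primesE)
  interpret P: primeideal P R by fact
  have "P \<noteq> {\<zero>}"
    using zeroprimeideal_domainI assms(1) P.primeideal_axioms by metis
  moreover have "x \<noteq> \<zero>"
    using x(2) P.I_notcarr l_null by blast
  moreover have "x \<in> annihilator R P"
  proof -
    have "s \<otimes> x = \<zero>" if "s \<in> P" for s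
      using x m_comm[of s x] that by metis
    then show ?thesis
      using x(1) unfolding annihilator_def by blast
  qed
  ultimately show ?thesis
    using P.is_ideal by (auto simp: annihilating_ideals_def)
qed

text \<open>No vertex is isolated, so total dominating sets exist. The double annihilator contains
  \<open>I\<close>, which makes the annihilator a vertex; it differs from \<open>I\<close> because
  an element of both has square zero.\<close>

lemma adjacent_annihilator:
  assumes red: "reduced_ring R" and I: "I \<in> annihilating_ideals R"
  shows "adjacent (annihilating_ideal_graph R) I (annihilator R I)"
proof -
  have id: "ideal I R" "I \<noteq> {\<zero>}" "annihilator R I \<noteq> {\<zero>}"
    using I by (auto simp: annihilating_ideals_def)
  interpret I: ideal I R by (rule id)
  have sub: "I \<subseteq> annihilator R (annihilator R I)"
    using I.Icarr by (auto simp: annihilator_def m_comm)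
  obtain i where i: "i \<in> I" "i \<noteq> \<zero>"
    using id I.zero_closed by blast
  then have "annihilator R (annihilator R I) \<noteq> {\<zero>}"
    using sub by auto
  moreover have "i \<notin> annihilator R I"
    using i I.Icarr reduced_square_eq_zero[OF red, of i] by (auto simp: annihilator_def)
  moreover have "I \<cdot> annihilator R I = {\<zero>}"
    using ideal_prod_eq_zero_iff[OF id(1) ideal_annihilator[OF id(1)]] by (auto simp: annihilator_def)
  ultimately show ?thesis
    using I i id ideal_annihilator[OF id(1)]
    by (auto simp: adjacent_annihilating_ideal_graph annihilating_ideals_def)
qed

lemma minimal_primes_eq_of_ideal_prod_zero:
  assumes "primeideal P R" "primeideal Q R" and prod: "P \<cdot> Q = {\<zero>}"
  shows "minimal_primes R \<subseteq> {P, Q}"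
proof
  fix M assume M: "M \<in> minimal_primes R"
  interpret M: primeideal M R using M by (simp add: minimal_primes_def)
  interpret P: primeideal P R by fact
  interpret Q: primeideal Q R by fact
  have "p \<otimes> q \<in> M" if "p \<in> P" "q \<in> Q" for p q
    using that prod ideal_prod_eq_zero_iff[OF P.is_ideal Q.is_ideal] by auto
  then have "p \<in> M \<or> q \<in> M" if "p \<in> P" "q \<in> Q" for p q
    using M.I_prime[of p q] that P.Icarr Q.Icarr by blast
  \<comment> \<open>One element of \<open>P\<close> outside \<open>M\<close> forces all of
    \<open>Q\<close> into \<open>M\<close>.\<close>
  then have "P \<subseteq> M \<or> Q \<subseteq> M"
    by blast
  then show "M \<in> {P, Q}"
    using M assms(1,2) by (auto simp: minimal_primes_def)
qed

text \<open>This shows that more than two minimal primes exclude a domain, so that the associated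
  primes are vertices.\<close>

lemma minimal_primes_domain:
  assumes "domain R"
  shows "minimal_primes R \<subseteq> {{\<zero>}}"
proof -
  have "primeideal {\<zero>} R"
    using assms by (simp add: domain.zeroprimeideal)
  moreover have "{\<zero>} \<cdot> {\<zero>} = {\<zero>}"
    using ideal_prod_eq_zero_iff[OF zeroideal zeroideal] by simp
  ultimately show ?thesis
    using minimal_primes_eq_of_ideal_prod_zero by blast
qed

end

lemma card_of_doubleton_le_ctwo: "|{a, b}| \<le>o ctwo"
proof -
  have "{a, b} = (\<lambda>t. if t then a else b) ` (UNIV :: bool set)"
    by (auto simp: UNIV_bool)
  then show ?thesis
    unfolding ctwo_def by (metis card_of_image)
qed

lemma not_subset_doubleton_of_ctwo_less:
  assumes "ctwo <o |A|"
  shows "\<not> A \<subseteq> {a, b}"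
  using assms card_of_mono1 card_of_doubleton_le_ctwo not_ordLess_ordLeq ordLeq_transitive by metis

theorem theorem4p3:
  fixes R :: "('a, 'b) ring_scheme"
  assumes "cring R" and "reduced_ring R"
  shows "(\<not> domain R \<longrightarrow>
            |bourbaki_primes R| \<le>o total_domination_number (annihilating_ideal_graph R)) \<and>
         (ctwo <o |minimal_primes R| \<longrightarrow>
            |bourbaki_primes R| \<le>o domination_number (annihilating_ideal_graph R))"
proof (intro conjI impI)
  interpret cring R by fact
  let ?G = "annihilating_ideal_graph R" and ?B = "bourbaki_primes R"
  note vertices = vertices_annihilating_ideal_graph[of R]
  note common = bourbaki_primes_common_neighbour[OF assms(2)]
  {
    assume nd: "\<not> domain R"
    have "annihilator R I \<in> annihilating_ideals R \<and> adjacent ?G I (annihilator R I)"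
      if "I \<in> annihilating_ideals R" for I
      using adjacent_annihilator[OF assms(2) that] by (simp add: adjacent_annihilating_ideal_graph)
    \<comment> \<open>The minimum is specified only for a nonempty family; the set of all vertices
      is a member.\<close>
    then have "total_dominating_set ?G (vertices ?G)"
      unfolding total_dominating_set_def vertices by blast
    then obtain S where S: "total_dominating_set ?G S" "total_domination_number ?G = |S|"
      using min_cardinality(1)[of "{S. total_dominating_set ?G S}"]
      unfolding total_domination_number_def by auto
    have "|?B| \<le>o |S|"
    proof (rule inj_choice_card_le)
      show "\<exists>s\<in>S. adjacent ?G P s" if "P \<in> ?B" for P
        using S(1) bourbaki_primes_are_vertices[OF nd that]
        by (auto simp: total_dominating_set_def vertices)
    qed (fact common)
    then show "|?B| \<le>o total_domination_number ?G"
      using S(2) by simp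
  next
    assume two: "ctwo <o |minimal_primes R|"
    have nd: "\<not> domain R"
      using minimal_primes_domain not_subset_doubleton_of_ctwo_less[OF two, of "{\<zero>\<^bsub>R\<^esub>}" "{\<zero>\<^bsub>R\<^esub>}"] by auto
    have "dominating_set ?G (vertices ?G)"
      by (simp add: dominating_set_def)
    then obtain D where D: "dominating_set ?G D" "domination_number ?G = |D|"
      using min_cardinality(1)[of "{D. dominating_set ?G D}"]
      unfolding domination_number_def by auto
    \<comment> \<open>An edge would give \<open>P \<cdot> Q = {\<zero>}\<close> and leave at most
      two minimal primes.\<close>
    have no_edge: "\<not> adjacent ?G P Q" if "P \<in> ?B" "Q \<in> ?B" for P Q
      using that minimal_primes_eq_of_ideal_prod_zero[of P Q] not_subset_doubleton_of_ctwo_less[OF two]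
      by (auto simp: adjacent_annihilating_ideal_graph bourbaki_primes_def)
    have "|?B| \<le>o |D|"
    proof (rule inj_choice_card_le)
      show "\<exists>d\<in>D. d = P \<or> adjacent ?G P d" if "P \<in> ?B" for P
        using D(1) bourbaki_primes_are_vertices[OF nd that]
        by (auto simp: dominating_set_def vertices)
    next
      \<comment> \<open>If \<open>d\<close> is one of the primes and a neighbour of the other,
        \<open>no_edge\<close> is violated; if \<open>d\<close> is adjacent to both,
        \<open>common\<close> applies.\<close>
      fix P Q d
      assume "P \<in> ?B" "Q \<in> ?B" "d = P \<or> adjacent ?G P d" "d = Q \<or> adjacent ?G Q d"
      then show "P = Q" using no_edge common by metis
    qed
    then show "|?B| \<le>o domination_number ?G"
      using D(2) by simp
  }
qed

end
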